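(* Let $n\ge 2$ be an integer and let $\lambda\ge 1$ be real. Then, for $(x,\nu)\in[0,1)^2$, the following holds. If $1\le\lambda<n$, then $$Z_\lambda B_n(x,\nu)=0 \iff (x,\nu)=(1/2,1/2).$$ If $\lambda\ge n$, then $$Z_\lambda B_n(x,\nu)=0 \iff x\in\left[\tfrac{n}{2\lambda},\,1-\tfrac{n}{2\lambda}\right]\ \text{and}\ \nu\in[0,1).$$
   Context: The centered B-splines $B_n:\mathbb{R}\to\mathbb{R}$, $n\in\mathbb{N}$, are defined recursively by $B_1=\chi_{[-1/2,1/2)}$ and $B_{n+1}=B_n*B_1$ (convolution). For $\lambda>0$ the Zak transform of $f$ is $$Z_\lambda f(x,\nu)=\sqrt{\lambda}\sum_{k\in\mathbb{Z}} f(\lambda(x-k))\,e^{2\pi i k\nu},\qquad (x,\nu)\in\mathbb{R}^2.$$ For $f=B_n$ the sum is finite for every $(x,\nu)$ and is understood pointwise. *)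

theory Defs
  imports "HOL-Analysis.Analysis"
begin

definition convolve :: "(real \<Rightarrow> real) \<Rightarrow> (real \<Rightarrow> real) \<Rightarrow> real \<Rightarrow> real" where
  "convolve f g x = (LINT t|lborel. f (x - t) * g t)"

text \<open>The B-splines are indexed by positive integers; the value at index 0 is a dummy.\<close>

fun bspline :: "nat \<Rightarrow> real \<Rightarrow> real" where
  "bspline 0 = (\<lambda>_. 0)"
| "bspline (Suc 0) = indicator {-1/2..<1/2}"
| "bspline (Suc (Suc n)) = convolve (bspline (Suc n)) (bspline (Suc 0))"

text \<open>The series is an unconditional sum over the integers, taken pointwise. For a function of
  bounded support, such as a B-spline, and \<open>lam > 0\<close> only finitely many terms are nonzero.\<close>

definition zak :: "real \<Rightarrow> (real \<Rightarrow> complex) \<Rightarrow> real \<Rightarrow> real \<Rightarrow> complex" where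
  "zak lam f x \<nu> = complex_of_real (sqrt lam) *
     (\<Sum>\<^sub>\<infinity>k\<in>(UNIV :: int set). f (lam * (x - of_int k)) *
        exp (2 * complex_of_real pi * \<i> * of_int k * complex_of_real \<nu>))"

end

theory Submission
  imports Defs
begin

text \<open>Put \<open>\<alpha> = 2 * pi * \<nu>\<close> and let \<open>F n t\<close> be the sum of \<open>B n (t - lam * k) * cis (k * \<alpha>)\<close> over the integers
  \<open>k\<close>, so that the Zak transform is \<open>sqrt lam\<close> times \<open>F n (lam * x)\<close>. Since \<open>B (n + 1)\<close> is the
  average of \<open>B n\<close> over windows of length 1, \<open>F (n + 1)\<close> is the average of \<open>F n\<close> over the same
  windows. They are not longer than the quasi-period \<open>lam\<close> of \<open>F n\<close>.

  Suppose first that \<open>lam < n\<close> and \<open>0 < \<alpha> < pi\<close>. Then the curve \<open>F n\<close> only turns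
  counterclockwise: whenever \<open>s \<le> t \<le> s + lam\<close>, the value at \<open>t\<close> is reached from the value at \<open>s\<close>
  by an angle between 0 and \<open>pi\<close>, that is, \<open>Im (cnj (F n s) * F n t) \<ge> 0\<close>. For \<open>n = 1\<close> this is
  clear, because \<open>F 1\<close> takes the value \<open>cis (k * \<alpha>)\<close> near \<open>lam * k\<close> and vanishes elsewhere, and
  averaging over windows of length at most \<open>lam\<close> preserves it (\<open>turning_window_mean\<close>). All values
  in one window lie in a cone of opening angle at most \<open>\<alpha> < pi\<close>, so the average can vanish only if
  the function vanishes on the whole window (\<open>turning_window_mean_zero\<close>). Hence a zero of \<open>F n\<close>
  forces \<open>F 1\<close> to vanish on an interval of length \<open>n - 1\<close>; but its gaps have length only
  \<open>lam - 1 < n - 1\<close>. So there is no zero. Angles between \<open>pi\<close> and \<open>2 * pi\<close> reduce to this case by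
  complex conjugation.

  For \<open>\<alpha> = 0\<close> the sum has nonnegative terms, at least one of them positive. For \<open>\<alpha> = pi\<close> the
  function \<open>F n\<close> is real, even and changes sign under the shift by \<open>lam\<close>, hence is odd about
  \<open>lam / 2\<close> and vanishes there. Between \<open>- lam / 2\<close> and \<open>lam / 2\<close> it is nonnegative, and positive at
  distance less than \<open>n / 2\<close> from 0, by induction: the part of a window beyond \<open>lam / 2\<close> cancels
  against its mirror image, and what is left lies where the preceding function is nonnegative
  (\<open>antiperiodic_window_mean_pos\<close>). As \<open>lam < n\<close>, it is positive on the whole open interval.

  If \<open>lam \<ge> n\<close>, the supports of the shifted splines do not overlap, so at most one term is nonzero,
  and the zeros are the points outside all the supports.\<close>

section \<open>Integrals over real intervals\<close>

lemma vanishing_integrals_imp_zero: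
  fixes f :: "real \<Rightarrow> 'a::banach"
  assumes int: "f integrable_on {p..q}" and zero: "\<And>m. m \<in> {p..q} \<Longrightarrow> integral {p..m} f = 0"
    and u: "p < u" "u < q" and cont: "isCont f u"
  shows "f u = 0"
proof -
  have nt: "at u within {p..q} \<noteq> bot"
    using u by (auto simp: trivial_limit_within islimpt_Icc)
  have d1: "((\<lambda>m. integral {p..m} f) has_vector_derivative f u) (at u within {p..q})"
    using integral_has_vector_derivative_continuous_at[OF int, of u "{}"] u
      continuous_at_imp_continuous_at_within[OF cont] by simp
  have d2: "((\<lambda>m. integral {p..m} f) has_vector_derivative 0) (at u within {p..q})"
    by (rule has_vector_derivative_transform[of _ _ _ "\<lambda>_. 0"]) (use u zero in auto)
  show ?thesis using vector_derivative_unique_within[OF nt d1 d2] .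
qed

lemma integral_positive_at_continuity_point:
  fixes f :: "real \<Rightarrow> real"
  assumes int: "f integrable_on {p..q}" and nonneg: "\<And>t. t \<in> {p..q} \<Longrightarrow> 0 \<le> f t"
    and u: "p < u" "u < q" and cont: "isCont f u" and pos: "0 < f u"
  shows "0 < integral {p..q} f"
proof (rule ccontr)
  have nn: "0 \<le> integral {a..b} f" if "p \<le> a" "b \<le> q" for a b
    by (rule Henstock_Kurzweil_Integration.integral_nonneg)
       (use that nonneg integrable_on_subinterval[OF int] in auto)
  assume "\<not> 0 < integral {p..q} f"
  then have z: "integral {p..q} f \<le> 0" by simp
  have "integral {p..m} f = 0" if "m \<in> {p..q}" for m
    using Henstock_Kurzweil_Integration.integral_combine[of p m q f] int that z nn[of p m] nn[of m q]
    by auto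
  from vanishing_integrals_imp_zero[OF int this u cont] pos show False by simp
qed

lemma integral_shift_real:
  fixes f :: "real \<Rightarrow> 'a::real_normed_vector"
  shows "integral {a+c..b+c} f = integral {a..b} (\<lambda>t. f (t + c))"
  using integral_shift_Icc_real[of a b f c] by (simp add: o_def add.commute)

lemma integral_reflect_about:
  fixes f :: "real \<Rightarrow> 'a::real_normed_vector"
  shows "integral {a..b} (\<lambda>t. f (c - t)) = integral {c - b..c - a} f"
  using integral_shift_real[of "-b" c "-a" f]
    Henstock_Kurzweil_Integration.integral_reflect_real[of b a "\<lambda>t. f (c - t)"]
  by (simp add: algebra_simps)

section \<open>Averages over windows of length one\<close>

definition window_mean :: "(real \<Rightarrow> 'a::banach) \<Rightarrow> real \<Rightarrow> 'a" where
  "window_mean f t = integral {t - 1/2..t + 1/2} f"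

text \<open>A class of functions that is preserved by averaging and contains the discontinuous step functions
  from which the splines start. Continuity is required only where \<open>f\<close> is nonzero: this is enough to
  conclude from vanishing integrals that \<open>f\<close> itself vanishes, not merely almost everywhere.\<close>

definition tame :: "(real \<Rightarrow> 'a::banach) \<Rightarrow> bool" where
  "tame f \<longleftrightarrow> (\<forall>a b. f integrable_on {a..b}) \<and> (\<forall>u. f u \<noteq> 0 \<longrightarrow> isCont f u)"

lemma tame_integrable: "tame f \<Longrightarrow> f integrable_on {a..b}"
  by (simp add: tame_def)

lemma isCont_window_mean:
  fixes f :: "real \<Rightarrow> 'a::banach"
  assumes int: "\<And>a b. f integrable_on {a..b}"
  shows "isCont (window_mean f) t"
proof -
  define P where "P s = integral {t - 2..s} f" for s
  have "continuous_on {t - 2..t + 2} P"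
    unfolding P_def by (rule indefinite_integral_continuous_1[OF int])
  then have P: "isCont P s" if "t - 2 < s" "s < t + 2" for s
    using that by (intro continuous_on_interior[of "{t - 2..t + 2}"]) auto
  have "window_mean f s = P (s + 1/2) - P (s - 1/2)" if "s \<in> {t - 1<..<t + 1}" for s
    using Henstock_Kurzweil_Integration.integral_combine[of "t - 2" "s - 1/2" "s + 1/2" f] int that
    by (auto simp: window_mean_def P_def algebra_simps)
  then have ev: "\<forall>\<^sub>F s in nhds t. window_mean f s = P (s + 1/2) - P (s - 1/2)"
    by (intro eventually_nhds_in_open[THEN eventually_mono, of "{t - 1<..<t + 1}"]) auto
  have "isCont (\<lambda>s. P (s + 1/2)) t" "isCont (\<lambda>s. P (s - 1/2)) t"
    by (rule isCont_o2[of t _ P]; use P in simp)+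
  then have "isCont (\<lambda>s. P (s + 1/2) - P (s - 1/2)) t"
    by (rule isCont_diff)
  then show ?thesis by (subst isCont_cong[OF ev])
qed

lemma tame_window_mean: "tame f \<Longrightarrow> tame (window_mean f)"
  using isCont_window_mean[of f]
  by (auto simp: tame_def intro!: integrable_continuous_real continuous_at_imp_continuous_on)

lemma window_mean_even:
  fixes f :: "real \<Rightarrow> 'a::banach"
  assumes "\<And>t. f (- t) = f t"
  shows "window_mean f (- t) = window_mean f t"
proof -
  have "(\<lambda>s. f (0 - s)) = f" using assms by auto
  then show ?thesis
    using integral_reflect_about[of "t - 1/2" "t + 1/2" f 0] by (simp add: window_mean_def algebra_simps)
qed

section \<open>Centered B-splines\<close>

text \<open>The centered B-spline of order \<open>m + 1\<close>, started from the indicator of the open interval. Unlike the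
  half-open one, this is an even function, and it is continuous wherever it is nonzero; the averages do
  not see the difference.\<close>

fun spline :: "nat \<Rightarrow> real \<Rightarrow> real" where
  "spline 0 = indicator {-1/2<..<1/2}"
| "spline (Suc m) = window_mean (spline m)"

lemma tame_indicator_interval:
  fixes c :: "'a::banach"
  shows "tame (\<lambda>t. indicator {a<..<b::real} t *\<^sub>R c)"
  unfolding tame_def
proof safe
  fix p q :: real
  have "(\<lambda>t. indicator {a<..<b} t *\<^sub>R c) integrable_on {p..q} \<longleftrightarrow> (\<lambda>_. c) integrable_on ({a<..<b} \<inter> {p..q})"
    by (subst integrable_restrict_Int[symmetric]) (auto intro!: integrable_cong simp: indicator_def)
  moreover have "(\<lambda>_. c) integrable_on ({a<..<b} \<inter> {p..q})"
    by (intro integrable_on_const) (auto intro: bounded_set_imp_lmeasurable)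
  ultimately show "(\<lambda>t. indicator {a<..<b} t *\<^sub>R c) integrable_on {p..q}" by blast
next
  fix u assume "indicator {a<..<b} u *\<^sub>R c \<noteq> 0"
  then have "u \<in> {a<..<b}" by (auto simp: indicator_def)
  then have "\<forall>\<^sub>F t in nhds u. indicator {a<..<b} t *\<^sub>R c = c"
    by (intro eventually_nhds_in_open[THEN eventually_mono, of "{a<..<b}"]) auto
  then show "isCont (\<lambda>t. indicator {a<..<b} t *\<^sub>R c) u"
    using isCont_cong by fastforce
qed

lemma tame_spline: "tame (spline m)"
proof (induction m)
  case 0
  then show ?case using tame_indicator_interval[of "-1/2" "1/2" "1::real"] by simp
qed (simp add: tame_window_mean)

lemma spline_even: "spline m (- t) = spline m t"
  by (induction m arbitrary: t) (auto simp: indicator_def intro: window_mean_even)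

lemma spline_nonneg: "0 \<le> spline m t"
  by (induction m arbitrary: t)
     (auto simp: window_mean_def intro!: Henstock_Kurzweil_Integration.integral_nonneg
        tame_integrable tame_spline)

lemma spline_eq_0: "\<bar>t\<bar> \<ge> (real m + 1) / 2 \<Longrightarrow> spline m t = 0"
proof (induction m arbitrary: t)
  case 0
  then show ?case by (auto simp: indicator_def)
next
  case (Suc m)
  have "spline m s = 0" if "s \<in> {t - 1/2..t + 1/2}" for s
    using that Suc by (intro Suc.IH) (auto simp: field_simps abs_if split: if_splits)
  then have "integral {t - 1/2..t + 1/2} (spline m) = integral {t - 1/2..t + 1/2} (\<lambda>_. 0)"
    by (intro Henstock_Kurzweil_Integration.integral_cong) auto
  then show ?case by (simp add: window_mean_def)
qed

lemma spline_pos: "\<bar>t\<bar> < (real m + 1) / 2 \<Longrightarrow> 0 < spline m t"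
proof (induction m arbitrary: t)
  case 0
  then show ?case by (auto simp: indicator_def)
next
  case (Suc m)
  \<comment> \<open>Shrinking \<open>t\<close> in the ratio of the supports moves it by less than half a window.\<close>
  define u where "u = t * (real m + 1) / (real m + 2)"
  have "u - t = - t / (real m + 2)" by (simp add: u_def field_simps)
  then have "\<bar>u - t\<bar> = \<bar>t\<bar> / (real m + 2)" by simp
  also have "\<dots> < 1/2" using Suc.prems by (simp add: field_simps)
  finally have near: "t - 1/2 < u" "u < t + 1/2" by (auto simp only: abs_less_iff)
  have "\<bar>u\<bar> = \<bar>t\<bar> / (real m + 2) * (real m + 1)" by (simp add: u_def abs_mult)
  also have "\<dots> < 1/2 * (real m + 1)"
    using Suc.prems by (intro mult_strict_right_mono) (auto simp: field_simps)
  finally have "0 < spline m u" by (intro Suc.IH) simp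
  moreover have "isCont (spline m) u"
    using tame_spline[of m] calculation by (auto simp: tame_def)
  ultimately show ?case
    using near by (auto simp: window_mean_def intro!: integral_positive_at_continuity_point[of _ _ _ u]
        tame_integrable tame_spline spline_nonneg)
qed

text \<open>The interval of integration comes out half-open on the other side, because \<open>s\<close> enters as \<open>t - s\<close>.\<close>

lemma convolve_box_eq_window_mean:
  assumes [measurable]: "f \<in> borel_measurable borel" and bound: "\<And>t. \<bar>f t\<bar> \<le> C"
  shows "convolve f (indicator {-1/2..<1/2}) t = window_mean f t"
proof -
  have "convolve f (indicator {-1/2..<1/2}) t
      = (LINT s|lborel. f s * indicator {-1/2..<1/2} (t - s))"
    unfolding convolve_def by (subst lborel_integral_real_affine[of "-1" _ t]) auto
  also have "\<dots> = (LINT s : {t - 1/2<..t + 1/2} | lborel. f s)"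
    unfolding set_lebesgue_integral_def
    by (intro Bochner_Integration.integral_cong) (auto simp: indicator_def)
  also have "\<dots> = integral {t - 1/2<..t + 1/2} f"
  proof (rule set_borel_integral_eq_integral)
    show "set_integrable lborel {t - 1/2<..t + 1/2} f"
      unfolding set_integrable_def
      by (rule integrableI_bounded_set[where A="{t - 1/2<..t + 1/2}" and B=C])
         (use bound in \<open>auto simp: indicator_def\<close>)
  qed
  also have "\<dots> = window_mean f t"
    unfolding window_mean_def
    by (intro integral_spike_set; rule negligible_subset[of "{t - 1/2}"]) auto
  finally show ?thesis .
qed

lemma spline_le_1: "spline m t \<le> 1"
proof (induction m arbitrary: t)
  case (Suc m)
  have "integral {t - 1/2..t + 1/2} (spline m) \<le> integral {t - 1/2..t + 1/2} (\<lambda>_. 1)"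
    by (intro integral_le) (auto intro: tame_integrable tame_spline Suc.IH)
  then show ?case by (simp add: window_mean_def)
qed (simp add: indicator_def)

lemma bspline_eq_spline: "bspline (Suc (Suc m)) = spline (Suc m)"
proof (induction m)
  case 0
  have "window_mean (indicator {-1/2..<1/2}) t = window_mean (indicator {-1/2<..<1/2} :: real \<Rightarrow> real) t" for t
    unfolding window_mean_def by (rule integral_spike[of "{-1/2}"]) (auto simp: indicator_def)
  moreover have "convolve (indicator {-1/2..<1/2}) (indicator {-1/2..<1/2}) t
      = window_mean (indicator {-1/2..<1/2}) t" for t
    by (rule convolve_box_eq_window_mean[where C=1]) (auto simp: indicator_def)
  ultimately show ?case by auto
next
  case (Suc m)
  have "continuous_on UNIV (spline (Suc m))"
    by (auto intro!: continuous_at_imp_continuous_on isCont_window_mean tame_integrable tame_spline)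
  then have "spline (Suc m) \<in> borel_measurable borel"
    by (rule borel_measurable_continuous_onI)
  then have "convolve (spline (Suc m)) (indicator {-1/2..<1/2}) t = window_mean (spline (Suc m)) t" for t
    by (rule convolve_box_eq_window_mean[where C=1])
       (simp only: abs_of_nonneg[OF spline_nonneg] spline_le_1)
  with Suc show ?case by auto
qed

section \<open>Quasi-periodic curves that turn in one direction\<close>

text \<open>For \<open>0 \<le> \<alpha> \<le> pi\<close>: a curve with quasi-period \<open>lam\<close> whose argument is
  nondecreasing and grows by \<open>\<alpha>\<close> in each period. The cross product \<open>Im (cnj a * b)\<close>
  expresses this without a choice of argument, and it still makes sense where the curve passes
  through 0.\<close>

definition turning :: "real \<Rightarrow> real \<Rightarrow> (real \<Rightarrow> complex) \<Rightarrow> bool" where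
  "turning lam \<alpha> F \<longleftrightarrow> (\<forall>t. F (t + lam) = cis \<alpha> * F t) \<and>
     (\<forall>s t. s \<le> t \<longrightarrow> t \<le> s + lam \<longrightarrow> 0 \<le> Im (cnj (F s) * F t))"

lemma integral_cross_nonneg:
  fixes F :: "real \<Rightarrow> complex"
  assumes int: "\<And>a b. F integrable_on {a..b}"
    and cross: "\<And>u v. u \<in> {a..b} \<Longrightarrow> v \<in> {c..d} \<Longrightarrow> 0 \<le> Im (cnj (F u) * F v)"
  shows "0 \<le> Im (cnj (integral {a..b} F) * integral {c..d} F)"
proof -
  have lin: "bounded_linear (\<lambda>w. Im (w * z))" "bounded_linear (\<lambda>w. Im (cnj w * z))"
    "bounded_linear (\<lambda>w. Im (z * w))" for z
    by (intro bounded_linear_compose[OF bounded_linear_Im] bounded_linear_mult_left bounded_linear_mult_right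
        bounded_linear_compose[OF bounded_linear_mult_left bounded_linear_cnj])+
  have inner: "0 \<le> Im (cnj (F u) * integral {c..d} F)" if u: "u \<in> {a..b}" for u
  proof -
    have "Im (cnj (F u) * integral {c..d} F) = integral {c..d} (\<lambda>v. Im (cnj (F u) * F v))"
      using integral_linear[OF int lin(3)[of "cnj (F u)"]] by (simp only: o_def)
    also have "0 \<le> \<dots>"
      using integrable_linear[OF int lin(3)[of "cnj (F u)"]] cross[OF u]
      by (intro Henstock_Kurzweil_Integration.integral_nonneg) (simp_all only: o_def)
    finally show ?thesis .
  qed
  have "Im (cnj (integral {a..b} F) * integral {c..d} F)
      = integral {a..b} (\<lambda>u. Im (cnj (F u) * integral {c..d} F))"
    using integral_linear[OF int lin(2)] by (simp add: o_def)
  also have "0 \<le> \<dots>"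
    using integrable_linear[OF int lin(2)] inner
    by (intro Henstock_Kurzweil_Integration.integral_nonneg) (auto simp: o_def)
  finally show ?thesis .
qed

lemma Im_cnj_mult_cis_self: "Im (cnj w * (cis \<alpha> * w)) = (cmod w)\<^sup>2 * sin \<alpha>"
proof -
  have "cnj w * (cis \<alpha> * w) = complex_of_real ((cmod w)\<^sup>2) * cis \<alpha>"
    by (simp add: complex_norm_square algebra_simps del: of_real_power)
  then show ?thesis by (simp only: Im_complex_of_real cis.sel times_complex.sel Re_complex_of_real)
qed

text \<open>The turning condition compares points at distance at most \<open>lam\<close>, but points of the two intervals
  can be up to \<open>r - p > lam\<close> apart. The end of the second interval that is too far from \<open>p\<close> is the
  translate by \<open>lam\<close> of an initial piece of the first one. Its integral is \<open>cis \<alpha>\<close> times the integral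
  over that piece, and a vector is turned counterclockwise by \<open>cis \<alpha>\<close> as \<open>sin \<alpha> \<ge> 0\<close>. All other
  pairs of pieces are close enough.\<close>

lemma turning_integrals:
  assumes F: "turning lam \<alpha> F" and int: "\<And>a b. F integrable_on {a..b}" and sin: "0 \<le> sin \<alpha>"
    and ord: "p \<le> q" "q \<le> q'" "q' \<le> r" "q' \<le> p + lam" "r \<le> q + lam"
  shows "0 \<le> Im (cnj (integral {p..q} F) * integral {q'..r} F)"
proof -
  have cross: "0 \<le> Im (cnj (integral {a..b} F) * integral {c..d} F)"
    if "b \<le> c" "d \<le> a + lam" for a b c d
    using that F by (intro integral_cross_nonneg[OF int]) (auto simp: turning_def)
  show ?thesis
  proof (cases "r \<le> p + lam")
    case True
    then show ?thesis using ord by (intro cross) auto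
  next
    case False
    define e where "e = r - lam"
    define A1 A2 B1 where "A1 = integral {p..e} F" and "A2 = integral {e..q} F"
      and "B1 = integral {q'..p + lam} F"
    define B2 where "B2 = integral {p + lam..r} F"
    have e: "p \<le> e" "e \<le> q" "r = e + lam" using False ord by (auto simp: e_def)
    have A: "integral {p..q} F = A1 + A2"
      using Henstock_Kurzweil_Integration.integral_combine[OF e(1,2) int] by (simp add: A1_def A2_def)
    have B: "integral {q'..r} F = B1 + B2"
      using Henstock_Kurzweil_Integration.integral_combine[of q' "p + lam" r F] int ord False
      by (simp add: B1_def B2_def)
    have "B2 = integral {p..e} (\<lambda>t. cis \<alpha> * F t)"
      using F unfolding B2_def e(3) integral_shift_real by (simp add: turning_def)
    then have B2: "B2 = cis \<alpha> * A1" by (simp add: A1_def)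
    have "0 \<le> Im (cnj A1 * B1)" "0 \<le> Im (cnj A2 * B1)" "0 \<le> Im (cnj A2 * B2)"
      unfolding A1_def A2_def B1_def B2_def using e ord by (intro cross; linarith)+
    moreover have "0 \<le> Im (cnj A1 * B2)"
      unfolding B2 Im_cnj_mult_cis_self using sin by simp
    ultimately show ?thesis
      unfolding A B by (simp add: algebra_simps)
  qed
qed

text \<open>Two windows that do not overlap are covered by \<open>turning_integrals\<close>. If they overlap, the first is
  \<open>A\<close> followed by \<open>C\<close> and the second is \<open>C\<close> followed by \<open>B\<close>; the cross product of the integral over \<open>C\<close>
  with itself is 0, and in the remaining pairs the intervals are in order again.\<close>

lemma turning_window_mean:
  assumes F: "turning lam \<alpha> F" and int: "\<And>a b. F integrable_on {a..b}" and sin: "0 \<le> sin \<alpha>"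
    and lam: "1 \<le> lam"
  shows "turning lam \<alpha> (window_mean F)"
  unfolding turning_def
proof (intro conjI allI impI)
  fix t
  have "window_mean F (t + lam) = integral {t - 1/2..t + 1/2} (\<lambda>s. cis \<alpha> * F s)"
    using F integral_shift_real[of "t - 1/2" lam "t + 1/2" F]
    by (simp add: window_mean_def turning_def algebra_simps)
  then show "window_mean F (t + lam) = cis \<alpha> * window_mean F t"
    by (simp add: window_mean_def)
next
  fix s t :: real
  assume st: "s \<le> t" "t \<le> s + lam"
  let ?I = "\<lambda>a b. integral {a..b} F"
  note combine = Henstock_Kurzweil_Integration.integral_combine[OF _ _ int, symmetric]
  note pos = turning_integrals[OF F int sin]
  show "0 \<le> Im (cnj (window_mean F s) * window_mean F t)"
  proof (cases "t \<le> s + 1")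
    case False
    then show ?thesis
      unfolding window_mean_def using st lam by (intro pos) auto
  next
    case True
    define A B C where "A = ?I (s - 1/2) (t - 1/2)" and "B = ?I (s + 1/2) (t + 1/2)"
      and "C = ?I (t - 1/2) (s + 1/2)"
    have S: "window_mean F s = A + C"
      unfolding window_mean_def A_def C_def using True st by (intro combine) auto
    have T: "window_mean F t = C + B"
      unfolding window_mean_def B_def C_def using True st by (intro combine) auto
    \<comment> \<open>The overlap contributes nothing against itself.\<close>
    have "Im (cnj (window_mean F s) * window_mean F t)
        = Im (cnj A * window_mean F t) + Im (cnj C * B)"
      unfolding S T by (simp add: algebra_simps)
    moreover have "0 \<le> Im (cnj A * window_mean F t)"
      unfolding A_def window_mean_def using st lam by (intro pos) auto
    moreover have "0 \<le> Im (cnj C * B)"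
      unfolding C_def B_def using st lam True by (intro pos) auto
    ultimately show ?thesis by simp
  qed
qed

text \<open>Cut the window at \<open>m\<close> and let \<open>J\<close> be the integral over the left piece, so that the right piece
  contributes \<open>- J\<close>. The left piece of the next period contributes \<open>cis \<alpha> * J\<close> and comes after the
  right piece, at distance at most \<open>lam\<close>. Turning from \<open>- J\<close> to \<open>cis \<alpha> * J\<close> is clockwise unless
  \<open>J = 0\<close>. As \<open>m\<close> is arbitrary, the function vanishes on the window.\<close>

lemma turning_window_mean_zero:
  assumes F: "turning lam \<alpha> F" and tame: "tame F" and sin: "0 < sin \<alpha>" and lam: "1 \<le> lam"
    and zero: "window_mean F t = 0" and u: "\<bar>u - t\<bar> < 1/2"
  shows "F u = 0"
proof (rule ccontr)
  assume nz: "F u \<noteq> 0"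
  note int = tame_integrable[OF tame]
  define p where "p = t - 1/2"
  have "integral {p..m} F = 0" if m: "m \<in> {p..p + 1}" for m
  proof -
    define J where "J = integral {p..m} F"
    have "integral {p..m} F + integral {m..p + 1} F = integral {p..p + 1} F"
      using m by (intro Henstock_Kurzweil_Integration.integral_combine int) auto
    then have K: "integral {m..p + 1} F = - J"
      using zero by (simp add: J_def p_def window_mean_def add_eq_0_iff add.commute)
    have "integral {p + lam..m + lam} F = integral {p..m} (\<lambda>t. cis \<alpha> * F t)"
      using F unfolding integral_shift_real by (simp add: turning_def)
    then have "integral {p + lam..m + lam} F = cis \<alpha> * J" by (simp add: J_def)
    moreover have "0 \<le> Im (cnj (integral {m..p + 1} F) * integral {p + lam..m + lam} F)"
      using m lam sin by (intro turning_integrals[OF F int]) auto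
    ultimately have "(cmod J)\<^sup>2 * sin \<alpha> \<le> 0"
      using Im_cnj_mult_cis_self[of J \<alpha>] unfolding K by simp
    then have "(cmod J)\<^sup>2 \<le> 0" using sin by (simp add: mult_le_0_iff)
    then show ?thesis by (simp add: J_def)
  qed
  moreover have "p < u" "u < p + 1" using u unfolding p_def by linarith+
  moreover have "isCont F u" using tame nz by (simp add: tame_def)
  ultimately show False using vanishing_integrals_imp_zero[OF int] nz by blast
qed

section \<open>Real functions that are even and antiperiodic\<close>

text \<open>By evenness only windows centered at \<open>s \<ge> 0\<close> need to be considered. Such a function is odd about
  \<open>lam / 2\<close>, so the part of the window beyond \<open>lam / 2\<close> cancels against its reflection. What is
  left of the window stays within distance \<open>lam / 2\<close> of 0 because \<open>lam \<ge> 1\<close>; it is nondegenerate if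
  \<open>s < lam / 2\<close>, and then it meets the interval of positivity as long as \<open>s < a + 1/2\<close>.\<close>

lemma antiperiodic_window_mean_pos:
  fixes f :: "real \<Rightarrow> real"
  assumes tame: "tame f" and even: "\<And>t. f (- t) = f t" and anti: "\<And>t. f (t + lam) = - f t"
    and nonneg: "\<And>t. \<bar>t\<bar> \<le> lam / 2 \<Longrightarrow> 0 \<le> f t"
    and pos: "\<And>t. \<bar>t\<bar> < a \<Longrightarrow> 0 < f t" and lam: "1 \<le> lam" and a: "0 < a"
  shows "\<bar>t\<bar> \<le> lam / 2 \<Longrightarrow> 0 \<le> window_mean f t"
    and "\<bar>t\<bar> < lam / 2 \<Longrightarrow> \<bar>t\<bar> < a + 1/2 \<Longrightarrow> 0 < window_mean f t"
proof -
  note int = tame_integrable[OF tame]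
  define s where "s = \<bar>t\<bar>"
  have s: "window_mean f t = window_mean f s"
    using window_mean_even[of f, OF even] by (auto simp: s_def abs_if)
  define r where "r = min (s + 1/2) (lam - s - 1/2)"
  have window: "window_mean f s = integral {s - 1/2..r} f" if "s \<le> lam / 2"
  proof (cases "s + 1/2 \<le> lam - s - 1/2")
    case True
    then show ?thesis by (simp add: window_mean_def r_def)
  next
    case False
    have odd: "f (lam - v) = - f v" for v
      using anti[of "- v"] even[of v] by (simp add: algebra_simps)
    have "integral {lam - s - 1/2..s + 1/2} f = integral {lam - s - 1/2..s + 1/2} (\<lambda>v. f (lam - v))"
      unfolding integral_reflect_about by (simp add: algebra_simps)
    also have "\<dots> = - integral {lam - s - 1/2..s + 1/2} f"
      unfolding odd by simp
    finally have "integral {lam - s - 1/2..s + 1/2} f = 0" by simp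
    moreover have "integral {s - 1/2..lam - s - 1/2} f + integral {lam - s - 1/2..s + 1/2} f
        = integral {s - 1/2..s + 1/2} f"
      using that False by (intro Henstock_Kurzweil_Integration.integral_combine int) auto
    ultimately show ?thesis using False by (simp add: window_mean_def r_def)
  qed
  have nn: "0 \<le> f v" if "v \<in> {s - 1/2..r}" for v
    using that lam by (intro nonneg) (auto simp: r_def s_def abs_le_iff)
  show "0 \<le> window_mean f t" if "\<bar>t\<bar> \<le> lam / 2"
    using that nn unfolding s
    by (subst window) (auto simp: s_def[symmetric] intro!: Henstock_Kurzweil_Integration.integral_nonneg int)
  show "0 < window_mean f t" if t: "\<bar>t\<bar> < lam / 2" "\<bar>t\<bar> < a + 1/2"
  proof -
    \<comment> \<open>The midpoint of the overlap of the reduced window with the interval of positivity.\<close>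
    define u where "u = (max (s - 1/2) (- a) + min r a) / 2"
    have "max (s - 1/2) (- a) < min r a"
      using t lam a by (auto simp: s_def[symmetric] r_def) (auto simp: s_def)
    then have u: "s - 1/2 < u" "u < r" "\<bar>u\<bar> < a"
      by (auto simp: u_def)
    with tame pos[of u] have "isCont f u" by (auto simp: tame_def)
    then show ?thesis
      unfolding s using t u pos[of u] nn
      by (subst window) (auto simp: s_def[symmetric] intro!: integral_positive_at_continuity_point[of _ _ _ u] int)
  qed
qed

section \<open>Twisted sums of shifted splines\<close>

text \<open>The Zak transform of the spline of order \<open>m + 1\<close> up to normalization, in the variable \<open>t = lam * x\<close>
  and with \<open>\<alpha> = 2 * pi * \<nu>\<close>. In the variable \<open>t\<close> the averaging windows have length 1.\<close>

definition twisted_sum :: "real \<Rightarrow> real \<Rightarrow> nat \<Rightarrow> real \<Rightarrow> complex" where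
  "twisted_sum lam \<alpha> m t =
     (\<Sum>\<^sub>\<infinity>k\<in>(UNIV :: int set). complex_of_real (spline m (t - lam * of_int k)) * cis (of_int k * \<alpha>))"

text \<open>The range of summation is not tied to the support at \<open>t\<close>: one value of \<open>M\<close> has to serve for all
  points of a window and for both \<open>m\<close> and \<open>m + 1\<close>.\<close>

lemma twisted_sum_finite:
  assumes "\<bar>t\<bar> + (real m + 1) / 2 \<le> lam * of_int M" and "0 < lam"
  shows "twisted_sum lam \<alpha> m t =
    (\<Sum>k\<in>{- M..M}. complex_of_real (spline m (t - lam * of_int k)) * cis (of_int k * \<alpha>))"
proof -
  have "spline m (t - lam * of_int k) = 0" if "k \<notin> {- M..M}" for k
  proof (rule spline_eq_0)
    have "of_int M \<le> \<bar>of_int k :: real\<bar>" using that by (auto simp: abs_if)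
    then have "lam * of_int M \<le> \<bar>lam * of_int k\<bar>" using assms(2) by (simp add: abs_mult)
    then show "(real m + 1) / 2 \<le> \<bar>t - lam * of_int k\<bar>" using assms(1) by linarith
  qed
  then have "twisted_sum lam \<alpha> m t = (\<Sum>\<^sub>\<infinity>k\<in>{- M..M}.
      complex_of_real (spline m (t - lam * of_int k)) * cis (of_int k * \<alpha>))"
    unfolding twisted_sum_def by (intro infsum_cong_neutral) auto
  then show ?thesis by simp
qed

lemma twisted_sum_single:
  assumes "\<And>j. j \<noteq> k \<Longrightarrow> (real m + 1) / 2 \<le> \<bar>t - lam * of_int j\<bar>"
  shows "twisted_sum lam \<alpha> m t = complex_of_real (spline m (t - lam * of_int k)) * cis (of_int k * \<alpha>)"
proof -
  have "twisted_sum lam \<alpha> m t = (\<Sum>\<^sub>\<infinity>k\<in>{k}.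
      complex_of_real (spline m (t - lam * of_int k)) * cis (of_int k * \<alpha>))"
    unfolding twisted_sum_def using assms by (intro infsum_cong_neutral) (auto intro: spline_eq_0)
  then show ?thesis by simp
qed

lemma twisted_sum_shift: "twisted_sum lam \<alpha> m (t + lam) = cis \<alpha> * twisted_sum lam \<alpha> m t"
proof -
  have "bij (\<lambda>k::int. k + 1)" by (rule bij_betw_byWitness[where f'="\<lambda>k. k - 1"]) auto
  then have "twisted_sum lam \<alpha> m (t + lam) = (\<Sum>\<^sub>\<infinity>k::int.
      complex_of_real (spline m (t + lam - lam * of_int (k + 1))) * cis (of_int (k + 1) * \<alpha>))"
    unfolding twisted_sum_def by (rule infsum_reindex_bij_betw[symmetric])
  also have "\<dots> = (\<Sum>\<^sub>\<infinity>k::int. cis \<alpha> *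
      (complex_of_real (spline m (t - lam * of_int k)) * cis (of_int k * \<alpha>)))"
    by (intro infsum_cong) (simp add: cis_mult algebra_simps flip: cis_mult)
  finally show ?thesis by (simp add: infsum_cmult_right' twisted_sum_def)
qed

lemma cis_of_int_full_turn: "cis (of_int k * (2 * pi) + x) = cis x"
  by (metis cis_mult cis_multiple_2pi Ints_of_int mult.commute mult_1)

lemma twisted_sum_reflect_angle:
  "twisted_sum lam (2 * pi - \<alpha>) m t = cnj (twisted_sum lam \<alpha> m t)"
proof -
  have "cis (of_int k * (2 * pi - \<alpha>)) = cnj (cis (of_int k * \<alpha>))" for k :: int
    using cis_of_int_full_turn[of k "- (of_int k * \<alpha>)"] by (simp add: algebra_simps cis_cnj)
  then show ?thesis unfolding twisted_sum_def by (simp flip: infsum_cnj)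
qed

lemma twisted_sum_pi_even: "twisted_sum lam pi m (- t) = twisted_sum lam pi m t"
proof -
  have "bij (uminus :: int \<Rightarrow> int)" by (rule bij_uminus)
  then have "twisted_sum lam pi m (- t) = (\<Sum>\<^sub>\<infinity>k::int.
      complex_of_real (spline m (- t - lam * of_int (- k))) * cis (of_int (- k) * pi))"
    unfolding twisted_sum_def by (rule infsum_reindex_bij_betw[symmetric])
  also have "\<dots> = twisted_sum lam pi m t"
  proof -
    have "spline m (- t - lam * of_int (- k)) = spline m (t - lam * of_int k)" for k :: int
      using spline_even[of m "t - lam * of_int k"] by (simp add: algebra_simps)
    moreover have "cis (of_int (- k) * pi) = cis (of_int k * pi)" for k :: int
      using cis_of_int_full_turn[of k "- (of_int k * pi)"] by (simp add: algebra_simps)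
    ultimately show ?thesis unfolding twisted_sum_def by simp
  qed
  finally show ?thesis .
qed

lemma twisted_sum_Suc:
  assumes lam: "0 < lam"
  shows "twisted_sum lam \<alpha> (Suc m) t = window_mean (twisted_sum lam \<alpha> m) t"
proof -
  define M :: int where "M = \<lceil>(\<bar>t\<bar> + (real (Suc m) + 1) / 2) / lam\<rceil>"
  have M: "\<bar>t\<bar> + (real (Suc m) + 1) / 2 \<le> lam * of_int M"
    using lam le_of_int_ceiling[of "(\<bar>t\<bar> + (real (Suc m) + 1) / 2) / lam"]
    unfolding M_def by (simp only: pos_divide_le_eq mult.commute)
  let ?c = "\<lambda>k::int. cis (of_int k * \<alpha>)"
  have shifted: "(\<lambda>s. complex_of_real (spline m (s - c)) * w) integrable_on {t - 1/2..t + 1/2} \<and>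
      integral {t - 1/2..t + 1/2} (\<lambda>s. complex_of_real (spline m (s - c)) * w)
      = complex_of_real (spline (Suc m) (t - c)) * w" for c w
  proof -
    have i: "(spline m has_integral spline (Suc m) (t - c)) {t - c - 1/2..t - c + 1/2}"
      by (simp add: window_mean_def has_integral_integral[symmetric] tame_integrable tame_spline)
    have "((\<lambda>s. spline m (s - c)) has_integral spline (Suc m) (t - c)) {t - 1/2..t + 1/2}"
      using has_integral_affinity_iff[of 1 "spline m" "- c"] i
        has_integral_shift_cbox_iff[of "spline m" "-c" "spline (Suc m) (t - c)" "t - 1/2" "t + 1/2"]
      by (simp add: algebra_simps o_def)
    then have "((\<lambda>s. complex_of_real (spline m (s - c)) * w) has_integral
        complex_of_real (spline (Suc m) (t - c)) * w) {t - 1/2..t + 1/2}"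
      by (intro has_integral_mult_left has_integral_of_real)
    then show ?thesis by (simp add: has_integral_iff)
  qed
  have "window_mean (twisted_sum lam \<alpha> m) t = integral {t - 1/2..t + 1/2}
      (\<lambda>s. \<Sum>k\<in>{- M..M}. complex_of_real (spline m (s - lam * of_int k)) * ?c k)"
    unfolding window_mean_def using M
    by (intro Henstock_Kurzweil_Integration.integral_cong twisted_sum_finite lam) (auto simp: field_simps abs_if split: if_splits)
  also have "\<dots> = (\<Sum>k\<in>{- M..M}. complex_of_real (spline (Suc m) (t - lam * of_int k)) * ?c k)"
    using shifted by (subst Henstock_Kurzweil_Integration.integral_sum) (simp_all only: finite_atLeastAtMost_int)
  also have "\<dots> = twisted_sum lam \<alpha> (Suc m) t"
    using twisted_sum_finite[OF M lam] by simp
  finally show ?thesis ..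
qed

lemma twisted_sum_0:
  assumes "1 \<le> lam" "\<bar>t - lam * of_int k\<bar> < 1/2"
  shows "twisted_sum lam \<alpha> 0 t = cis (of_int k * \<alpha>)"
proof -
  have "1/2 \<le> \<bar>t - lam * of_int j\<bar>" if "j \<noteq> k" for j
  proof -
    have "1 \<le> \<bar>of_int k - of_int j :: real\<bar>" using that by (simp flip: of_int_diff of_int_abs)
    then have "1 \<le> \<bar>lam * (of_int k - of_int j)\<bar>"
      using assms(1) mult_mono[of 1 lam 1 "\<bar>of_int k - of_int j\<bar>"] by (simp add: abs_mult)
    then show ?thesis using assms(2) unfolding right_diff_distrib by linarith
  qed
  then have "twisted_sum lam \<alpha> 0 t
      = complex_of_real (spline 0 (t - lam * of_int k)) * cis (of_int k * \<alpha>)"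
    by (intro twisted_sum_single) auto
  moreover have "t - lam * of_int k \<in> {-1/2<..<1/2}"
    using assms(2) unfolding abs_less_iff by simp
  ultimately show ?thesis by simp
qed

lemma twisted_sum_0_nonzeroE:
  assumes "twisted_sum lam \<alpha> 0 t \<noteq> 0"
  obtains k :: int where "\<bar>t - lam * of_int k\<bar> < 1/2"
proof -
  have "\<exists>k::int. spline 0 (t - lam * of_int k) \<noteq> 0"
  proof (rule ccontr)
    assume "\<nexists>k::int. spline 0 (t - lam * of_int k) \<noteq> 0"
    then have "twisted_sum lam \<alpha> 0 t = 0" by (simp add: twisted_sum_def del: spline.simps)
    with assms show False ..
  qed
  then show thesis using that spline_eq_0[of 0] by (metis not_le of_nat_0 add_0)
qed

lemma tame_twisted_sum:
  assumes lam: "1 \<le> lam"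
  shows "tame (twisted_sum lam \<alpha> m)"
proof (induction m)
  case 0
  show ?case
    unfolding tame_def
  proof safe
    fix a b :: real
    define M :: int where "M = \<lceil>\<bar>a\<bar> + \<bar>b\<bar> + 1/2\<rceil>"
    have "\<bar>a\<bar> + \<bar>b\<bar> + 1/2 \<le> of_int M" unfolding M_def by (rule le_of_int_ceiling)
    moreover have "of_int M \<le> lam * of_int M"
      using lam calculation by (simp add: mult_le_cancel_right1)
    ultimately have M: "\<bar>a\<bar> + \<bar>b\<bar> + 1/2 \<le> lam * of_int M" by linarith
    have "(\<lambda>t. \<Sum>k\<in>{- M..M}. complex_of_real (spline 0 (t - lam * of_int k)) * cis (of_int k * \<alpha>))
        integrable_on {a..b}"
    proof (rule Henstock_Kurzweil_Integration.integrable_sum)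
      fix k :: int
      let ?c = "lam * of_int k"
      have "(\<lambda>t. complex_of_real (spline 0 (t - ?c)) * cis (of_int k * \<alpha>))
          = (\<lambda>t. indicator {?c - 1/2<..<?c + 1/2} t *\<^sub>R cis (of_int k * \<alpha>))"
        by (auto simp: indicator_def fun_eq_iff)
      then show "(\<lambda>t. complex_of_real (spline 0 (t - ?c)) * cis (of_int k * \<alpha>)) integrable_on {a..b}"
        using tame_integrable[OF tame_indicator_interval] by simp
    qed simp
    then show "twisted_sum lam \<alpha> 0 integrable_on {a..b}"
      by (rule Henstock_Kurzweil_Integration.integrable_eq)
         (rule twisted_sum_finite[symmetric]; use M lam in auto)
  next
    fix u assume "twisted_sum lam \<alpha> 0 u \<noteq> 0"
    then obtain k :: int where k: "\<bar>u - lam * of_int k\<bar> < 1/2" by (rule twisted_sum_0_nonzeroE)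
    have "\<forall>\<^sub>F t in nhds u. twisted_sum lam \<alpha> 0 t = cis (of_int k * \<alpha>)"
      by (rule eventually_nhds_in_open[THEN eventually_mono, of "ball (lam * of_int k) (1/2)"])
         (use k in \<open>auto simp: dist_real_def abs_minus_commute intro!: twisted_sum_0 lam\<close>)
    then show "isCont (twisted_sum lam \<alpha> 0) u"
      using isCont_cong by fastforce
  qed
next
  case (Suc m)
  have "twisted_sum lam \<alpha> (Suc m) = window_mean (twisted_sum lam \<alpha> m)"
    using lam by (intro ext twisted_sum_Suc) simp
  then show ?case using tame_window_mean[OF Suc] by simp
qed

text \<open>For \<open>m = 0\<close> a nonzero value at \<open>t\<close> comes from the same multiple of \<open>lam\<close> as the one at \<open>s \<le> t\<close> or
  from the next one, since the supports have length \<open>1 \<le> lam\<close>.\<close>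

lemma turning_twisted_sum:
  assumes lam: "1 \<le> lam" and sin: "0 \<le> sin \<alpha>"
  shows "turning lam \<alpha> (twisted_sum lam \<alpha> m)"
proof (induction m)
  case 0
  have "0 \<le> Im (cnj (twisted_sum lam \<alpha> 0 s) * twisted_sum lam \<alpha> 0 t)"
    if st: "s \<le> t" "t \<le> s + lam" for s t
  proof (cases "twisted_sum lam \<alpha> 0 s = 0 \<or> twisted_sum lam \<alpha> 0 t = 0")
    case False
    then obtain j k :: int where j: "\<bar>s - lam * of_int j\<bar> < 1/2" and k: "\<bar>t - lam * of_int k\<bar> < 1/2"
      by (metis twisted_sum_0_nonzeroE)
    have "- lam < lam * of_int (k - j)" "lam * of_int (k - j) < lam * 2"
      using j k st lam unfolding abs_less_iff by (auto simp: algebra_simps)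
    then have "- 1 < (of_int (k - j) :: real)" "(of_int (k - j) :: real) < 2"
      using lam mult_less_cancel_left_pos[of lam "- 1" "of_int (k - j)"] by auto
    then have "k = j \<or> k = j + 1" by linarith
    moreover have "cnj (twisted_sum lam \<alpha> 0 s) * twisted_sum lam \<alpha> 0 t = cis (of_int (k - j) * \<alpha>)"
      unfolding twisted_sum_0[OF lam j] twisted_sum_0[OF lam k]
      by (simp add: cis_cnj cis_mult algebra_simps)
    ultimately show ?thesis using sin by auto
  qed auto
  then show ?case by (simp add: turning_def twisted_sum_shift)
next
  case (Suc m)
  have "twisted_sum lam \<alpha> (Suc m) = window_mean (twisted_sum lam \<alpha> m)"
    using lam by (intro ext twisted_sum_Suc) simp
  then show ?case
    using turning_window_mean[OF Suc tame_integrable[OF tame_twisted_sum[OF lam]] sin lam] by simp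
qed

text \<open>A zero of an average spreads to its window at each of the \<open>m\<close> steps down to the step function. The
  alternative \<open>u = t\<close> covers \<open>m = 0\<close>, where no room is gained.\<close>

lemma twisted_sum_zero_descends:
  assumes lam: "1 \<le> lam" and sin: "0 < sin \<alpha>"
    and "twisted_sum lam \<alpha> m t = 0" "u = t \<or> \<bar>u - t\<bar> < real m / 2"
  shows "twisted_sum lam \<alpha> 0 u = 0"
  using assms(3,4)
proof (induction m arbitrary: t)
  case (Suc m)
  \<comment> \<open>Dividing the distance into equal steps keeps each of them below \<open>1/2\<close>.\<close>
  define v where "v = t + (u - t) / (real m + 1)"
  have "\<bar>u - t\<bar> < (real m + 1) / 2" using Suc.prems by auto
  then have ut: "\<bar>u - t\<bar> / (real m + 1) < 1/2" by (simp add: field_simps)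
  have "u - v = (u - t) / (real m + 1) * real m" by (simp add: v_def field_simps)
  then have "\<bar>u - v\<bar> = \<bar>u - t\<bar> / (real m + 1) * real m" by (simp add: abs_mult)
  with ut have "u = v \<or> \<bar>u - v\<bar> < real m / 2"
    using mult_strict_right_mono[OF ut, of "real m"] by (cases "m = 0") auto
  moreover have "\<bar>v - t\<bar> < 1/2" using ut by (simp add: v_def)
  then have "twisted_sum lam \<alpha> m v = 0"
    using Suc.prems twisted_sum_Suc[of lam \<alpha> m t] lam sin
    by (intro turning_window_mean_zero[OF turning_twisted_sum tame_twisted_sum]) auto
  ultimately show ?case using Suc.IH by blast
qed simp

section \<open>Zeros of the twisted sums\<close>

lemma exists_close_multiple:
  fixes lam t :: real
  assumes "0 < lam"
  shows "\<exists>k::int. \<bar>t - lam * of_int k\<bar> \<le> lam / 2"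
proof -
  have "t - lam * of_int (round (t / lam)) = lam * - (of_int (round (t / lam)) - t / lam)"
    using assms by (simp add: algebra_simps)
  then have "\<bar>t - lam * of_int (round (t / lam))\<bar> = lam * \<bar>of_int (round (t / lam)) - t / lam\<bar>"
    using assms by (simp add: abs_mult)
  also have "\<dots> \<le> lam * (1/2)"
    using assms by (intro mult_left_mono of_int_round_abs_le) auto
  finally show ?thesis by auto
qed

text \<open>The point \<open>u\<close> divides the segment between \<open>t\<close> and the nearest multiple of \<open>lam\<close> so that it is close
  enough to \<open>t\<close> to inherit a zero and close enough to the multiple to lie in the support of the step
  function. This is where \<open>lam < m + 1\<close> enters: the segment has length at most \<open>lam / 2\<close>.\<close>

lemma twisted_sum_nonzero_generic:
  assumes lam: "1 \<le> lam" "lam < real m + 1" and sin: "0 < sin \<alpha>"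
  shows "twisted_sum lam \<alpha> m t \<noteq> 0"
proof
  assume zero: "twisted_sum lam \<alpha> m t = 0"
  obtain k :: int where k: "\<bar>t - lam * of_int k\<bar> \<le> lam / 2"
    using exists_close_multiple[of lam t] lam by auto
  define d where "d = (t - lam * of_int k) / (real m + 1)"
  define u where "u = lam * of_int k + d"
  have d: "\<bar>d\<bar> < 1/2" using k lam by (auto simp: d_def field_simps)
  have "u - t = - (d * real m)" by (simp add: u_def d_def field_simps)
  then have "\<bar>u - t\<bar> = \<bar>d\<bar> * real m" by (simp add: abs_mult)
  then have "u = t \<or> \<bar>u - t\<bar> < real m / 2"
    using mult_strict_right_mono[OF d, of "real m"] by (cases "m = 0") auto
  from twisted_sum_zero_descends[OF lam(1) sin zero this]
  have "twisted_sum lam \<alpha> 0 u = 0" .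
  moreover have "twisted_sum lam \<alpha> 0 u = cis (of_int k * \<alpha>)"
    using d by (intro twisted_sum_0 lam) (simp add: u_def)
  ultimately show False by simp
qed

lemma twisted_sum_nonzero_angle_0:
  assumes lam: "0 < lam" "lam < real m + 1"
  shows "twisted_sum lam 0 m t \<noteq> 0"
proof -
  obtain k :: int where k: "\<bar>t - lam * of_int k\<bar> \<le> lam / 2"
    using exists_close_multiple[of lam t] lam by auto
  define M :: int where "M = max \<bar>k\<bar> \<lceil>(\<bar>t\<bar> + (real m + 1) / 2) / lam\<rceil>"
  have "(\<bar>t\<bar> + (real m + 1) / 2) / lam \<le> of_int M"
    unfolding M_def of_int_max by (rule max.coboundedI2[OF le_of_int_ceiling])
  then have M: "\<bar>t\<bar> + (real m + 1) / 2 \<le> lam * of_int M"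
    using lam by (simp only: pos_divide_le_eq mult.commute)
  have "0 < (\<Sum>j\<in>{- M..M}. spline m (t - lam * of_int j))"
    using k lam by (intro sum_pos2[of _ k]) (auto simp: M_def spline_nonneg intro: spline_pos)
  moreover have "twisted_sum lam 0 m t = of_real (\<Sum>j\<in>{- M..M}. spline m (t - lam * of_int j))"
    using twisted_sum_finite[OF M lam(1)] by simp
  ultimately show ?thesis by (metis of_real_eq_0_iff less_irrefl)
qed

text \<open>Two cutoffs limit the positivity: the support of the central spline, which grows by \<open>1/2\<close> on each
  side when \<open>m\<close> increases, and the zeros forced by symmetry at distance \<open>lam / 2\<close>.\<close>

lemma Re_twisted_sum_pi:
  assumes lam: "1 \<le> lam"
  shows "\<bar>t\<bar> \<le> lam / 2 \<Longrightarrow> 0 \<le> Re (twisted_sum lam pi m t)"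
    and "\<bar>t\<bar> < lam / 2 \<Longrightarrow> \<bar>t\<bar> < (real m + 1) / 2 \<Longrightarrow> 0 < Re (twisted_sum lam pi m t)"
proof (induction m arbitrary: t)
  case 0
  have central: "twisted_sum lam pi 0 t = complex_of_real (spline 0 t)" if t: "\<bar>t\<bar> \<le> lam / 2" for t
  proof -
    have "1/2 \<le> \<bar>t - lam * of_int j\<bar>" if "j \<noteq> 0" for j
    proof -
      have "1 \<le> \<bar>of_int j :: real\<bar>" using that by (simp flip: of_int_abs)
      then have "lam \<le> \<bar>lam * of_int j\<bar>" using lam by (simp add: abs_mult)
      then show ?thesis using t lam by linarith
    qed
    then show ?thesis using twisted_sum_single[of 0 0 t lam pi] by simp
  qed
  {
    case 1
    then show ?case using central[of t] spline_nonneg[of 0 t] by simp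
  next
    case 2
    then show ?case using central[of t] spline_pos[of t 0] by simp
  }
next
  case (Suc m)
  define f where "f t = Re (twisted_sum lam pi m t)" for t
  note tame = tame_twisted_sum[OF lam, of pi m]
  have "f integrable_on {a..b}" for a b
    using integrable_linear[OF tame_integrable[OF tame] bounded_linear_Re] by (simp add: f_def[abs_def] o_def)
  moreover have "isCont f u" if "f u \<noteq> 0" for u
    using that tame unfolding tame_def f_def[abs_def] by (metis isCont_Re zero_complex.sel(1))
  ultimately have f: "tame f" by (simp add: tame_def)
  have mean: "Re (twisted_sum lam pi (Suc m) t) = window_mean f t" for t
    using integral_linear[OF tame_integrable[OF tame] bounded_linear_Re] lam
    by (simp add: twisted_sum_Suc window_mean_def f_def[abs_def] o_def)
  have even: "f (- t) = f t" and anti: "f (t + lam) = - f t" for t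
    by (simp_all add: f_def twisted_sum_pi_even twisted_sum_shift)
  define a where "a = min (lam / 2) ((real m + 1) / 2)"
  have "0 < a" using lam by (simp add: a_def)
  moreover have "0 \<le> f t" if "\<bar>t\<bar> \<le> lam / 2" for t
    using Suc.IH(1)[OF that] by (simp add: f_def)
  moreover have "0 < f t" if "\<bar>t\<bar> < a" for t
    using Suc.IH(2)[of t] that by (simp add: f_def a_def)
  ultimately have pos: "\<bar>t\<bar> \<le> lam / 2 \<Longrightarrow> 0 \<le> window_mean f t"
      "\<bar>t\<bar> < lam / 2 \<Longrightarrow> \<bar>t\<bar> < a + 1/2 \<Longrightarrow> 0 < window_mean f t" for t
    using antiperiodic_window_mean_pos[of f lam a t, OF f even anti _ _ lam] by blast+
  {
    case 1
    then show ?case unfolding mean by (rule pos(1))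
  next
    case 2
    then show ?case unfolding mean by (intro pos(2)) (auto simp: a_def min_def field_simps)
  }
qed

lemma twisted_sum_half_period:
  "twisted_sum lam pi m (lam / 2) = 0"
  using twisted_sum_shift[of lam pi m "- (lam / 2)"] twisted_sum_pi_even[of lam m "lam / 2"]
  by (simp add: algebra_simps)

lemma twisted_sum_eq_0_iff_dense:
  assumes lam: "1 \<le> lam" "lam < real m + 1" and x: "0 \<le> x" "x < 1" and \<nu>: "0 \<le> \<nu>" "\<nu> < 1"
  shows "twisted_sum lam (2 * pi * \<nu>) m (lam * x) = 0 \<longleftrightarrow> x = 1/2 \<and> \<nu> = 1/2"
proof -
  consider "\<nu> = 0" | "0 < \<nu>" "\<nu> < 1/2" | "\<nu> = 1/2" | "1/2 < \<nu>"
    by atomize_elim (use \<nu> in auto)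
  then show ?thesis
  proof cases
    case 1
    then show ?thesis using twisted_sum_nonzero_angle_0[of lam m "lam * x"] lam by simp
  next
    case 2
    then have "0 < sin (2 * pi * \<nu>)" by (intro sin_gt_zero) auto
    then show ?thesis using twisted_sum_nonzero_generic[OF lam] 2 by simp
  next
    case 4
    have "2 * pi * \<nu> = 2 * pi - 2 * pi * (1 - \<nu>)" by (simp add: algebra_simps)
    moreover have "0 < sin (2 * pi * (1 - \<nu>))" using 4 \<nu> by (intro sin_gt_zero) auto
    ultimately show ?thesis
      using twisted_sum_nonzero_generic[OF lam, of "2 * pi * (1 - \<nu>)" "lam * x"] 4
      by (simp add: twisted_sum_reflect_angle)
  next
    case 3
    have nz: "twisted_sum lam pi m t \<noteq> 0" if "\<bar>t\<bar> < lam / 2" for t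
      using Re_twisted_sum_pi(2)[OF lam(1) that, of m] that lam by auto
    have "twisted_sum lam pi m (lam * x) \<noteq> 0" if "x \<noteq> 1/2"
    proof (cases "x < 1/2")
      case True
      then show ?thesis using lam x by (intro nz) (auto simp: abs_mult)
    next
      case False
      have "twisted_sum lam pi m (lam * x) = - twisted_sum lam pi m (lam * (x - 1))"
        using twisted_sum_shift[of lam pi m "lam * (x - 1)"] by (simp add: algebra_simps)
      moreover have "\<bar>lam * (x - 1)\<bar> < lam / 2"
        using False that x lam by (simp add: abs_mult)
      ultimately show ?thesis using nz by simp
    qed
    moreover have "twisted_sum lam pi m (lam * (1/2)) = 0"
      using twisted_sum_half_period by simp
    moreover have "2 * pi * \<nu> = pi" using 3 by simp
    ultimately show ?thesis using 3 by metis
  qed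
qed

text \<open>The multiple of \<open>lam\<close> nearest to \<open>lam * x\<close> is the only one whose spline can be nonzero there.\<close>

lemma twisted_sum_eq_0_iff_sparse:
  assumes lam: "real m + 1 \<le> lam" and x: "0 \<le> x" "x < 1"
  shows "twisted_sum lam \<alpha> m (lam * x) = 0
    \<longleftrightarrow> x \<in> {(real m + 1) / (2 * lam)..1 - (real m + 1) / (2 * lam)}"
proof -
  define h where "h = (real m + 1) / (2 * lam)"
  have l0: "0 < lam" using lam by linarith
  have h: "h \<le> 1/2" using lam l0 by (simp add: h_def field_simps)
  have scale: "\<bar>lam * x - lam * of_int j\<bar> = lam * \<bar>x - of_int j\<bar>" for j :: int
    using l0 by (simp add: abs_mult flip: right_diff_distrib)
  have far: "(real m + 1) / 2 \<le> \<bar>lam * x - lam * of_int j\<bar> \<longleftrightarrow> h \<le> \<bar>x - of_int j\<bar>" for j :: int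
    unfolding scale h_def using l0 by (simp add: field_simps)
  define k :: int where "k = (if x \<le> 1/2 then 0 else 1)"
  have "h \<le> \<bar>x - of_int j\<bar>" if "j \<noteq> k" for j
  proof -
    have "j \<le> k - 1 \<or> k + 1 \<le> j" using that by auto
    then have "of_int j \<le> (of_int k - 1 :: real) \<or> of_int k + 1 \<le> (of_int j :: real)"
      by (metis of_int_1 of_int_add of_int_diff of_int_le_iff)
    then have "1/2 \<le> \<bar>x - of_int j\<bar>" using x by (auto simp: k_def split: if_splits)
    with h show ?thesis by linarith
  qed
  then have "twisted_sum lam \<alpha> m (lam * x)
      = complex_of_real (spline m (lam * x - lam * of_int k)) * cis (of_int k * \<alpha>)"
    by (intro twisted_sum_single) (simp only: far)
  then have "twisted_sum lam \<alpha> m (lam * x) = 0 \<longleftrightarrow> spline m (lam * x - lam * of_int k) = 0" by simp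
  also have "\<dots> \<longleftrightarrow> h \<le> \<bar>x - of_int k\<bar>"
    using far[of k] spline_eq_0[of m "lam * x - lam * of_int k"] spline_pos[of "lam * x - lam * of_int k" m]
    by linarith
  also have "\<dots> \<longleftrightarrow> x \<in> {h..1 - h}" using x h by (auto simp: k_def)
  finally show ?thesis unfolding h_def .
qed

lemma zak_bspline:
  "zak lam (\<lambda>t. complex_of_real (bspline (Suc (Suc m)) t)) x \<nu>
    = complex_of_real (sqrt lam) * twisted_sum lam (2 * pi * \<nu>) (Suc m) (lam * x)"
  unfolding zak_def twisted_sum_def bspline_eq_spline
  by (simp add: cis_conv_exp right_diff_distrib mult_ac)

theorem corollary5p1:
  fixes n :: nat and lam x \<nu> :: real
  assumes "n \<ge> 2" and "lam \<ge> 1" and "(x, \<nu>) \<in> {0..<1} \<times> {0..<1}"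
  shows "(lam < real n \<longrightarrow>
            (zak lam (\<lambda>t. complex_of_real (bspline n t)) x \<nu> = 0
              \<longleftrightarrow> (x, \<nu>) = (1/2, 1/2))) \<and>
         (lam \<ge> real n \<longrightarrow>
            (zak lam (\<lambda>t. complex_of_real (bspline n t)) x \<nu> = 0
              \<longleftrightarrow> x \<in> {real n / (2 * lam)..1 - real n / (2 * lam)} \<and> \<nu> \<in> {0..<1}))"
proof -
  obtain m where n: "n = Suc (Suc m)"
    using assms(1) by (metis Suc_le_D numeral_2_eq_2 Suc_le_mono)
  have x: "0 \<le> x" "x < 1" and \<nu>: "0 \<le> \<nu>" "\<nu> < 1" using assms(3) by auto
  have rn: "real n = real (Suc m) + 1" using n by simp
  have zak: "zak lam (\<lambda>t. complex_of_real (bspline n t)) x \<nu> = 0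
      \<longleftrightarrow> twisted_sum lam (2 * pi * \<nu>) (Suc m) (lam * x) = 0"
    unfolding n zak_bspline using assms(2) by simp
  show ?thesis
    unfolding zak rn
    using twisted_sum_eq_0_iff_dense[OF assms(2) _ x \<nu>, of "Suc m"]
      twisted_sum_eq_0_iff_sparse[OF _ x, of "Suc m" lam "2 * pi * \<nu>"] \<nu> by simp
qed

end
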